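(* For every integer $r\ge 2$ there exists a finite family $\mathcal{F}$ of $r$-graphs such that $$\operatorname{sat}(\mathcal{F},n)=\begin{cases} O(n) & \text{if } n \text{ is even},\\ \Omega\left(n^{r-1}\right) & \text{if } n \text{ is odd}.\end{cases}$$
   Context: An $r$-graph $H$ is a pair $(V(H),E(H))$ where $V(H)$ is a finite set of vertices and the edge set $E(H)$ is a collection of $r$-element subsets of $V(H)$. Write $|H|=|V(H)|$ and $e(H)=|E(H)|$. Containment of one $r$-graph in another as a subgraph means containing a (not necessarily induced) copy of it. For a family $\mathcal{F}$ of $r$-graphs, an $r$-graph $H$ is called $\mathcal{F}$-saturated if it does not contain any graph in $\mathcal{F}$ as a subgraph, but adding any extra edge (that is, any $r$-element subset of $V(H)$ not in $E(H)$) to $H$ creates a copy of some graph $F\in\mathcal{F}$ as a subgraph. The saturation number is $$\operatorname{sat}(\mathcal{F},n)=\min\{e(H): |H|=n \text{ and } H \text{ is } \mathcal{F}\text{-saturated}\}.$$ The notations $O(\cdot)$ and $\Omega(\cdot)$ are asymptotic as $n\to\infty$ along the indicated values of $n$ (even, respectively odd), with $r$ and $\mathcal{F}$ fixed. *)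

theory Defs
  imports Complex_Main "HOL-Library.Landau_Symbols"
begin

type_synonym 'a hypergraph = "'a set \<times> 'a set set"

abbreviation verts :: "'a hypergraph \<Rightarrow> 'a set" where
  "verts H \<equiv> fst H"

abbreviation edges :: "'a hypergraph \<Rightarrow> 'a set set" where
  "edges H \<equiv> snd H"

definition r_graph :: "nat \<Rightarrow> 'a hypergraph \<Rightarrow> bool" where
  "r_graph r H \<longleftrightarrow> finite (verts H) \<and> (\<forall>e\<in>edges H. e \<subseteq> verts H \<and> card e = r)"

text \<open>Copies are not required to be induced.\<close>

definition contains_copy :: "'a hypergraph \<Rightarrow> 'b hypergraph \<Rightarrow> bool" where
  "contains_copy H F \<longleftrightarrow>
     (\<exists>\<phi>. inj_on \<phi> (verts F) \<and> \<phi> ` verts F \<subseteq> verts H \<and> (\<forall>e\<in>edges F. \<phi> ` e \<in> edges H))"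

definition saturated :: "nat \<Rightarrow> 'b hypergraph set \<Rightarrow> 'a hypergraph \<Rightarrow> bool" where
  "saturated r \<F> H \<longleftrightarrow>
     r_graph r H \<and>
     (\<forall>F\<in>\<F>. \<not> contains_copy H F) \<and>
     (\<forall>e. e \<subseteq> verts H \<and> card e = r \<and> e \<notin> edges H \<longrightarrow>
        (\<exists>F\<in>\<F>. contains_copy (verts H, insert e (edges H)) F))"

text \<open>Every finite hypergraph is isomorphic to one whose vertices are natural numbers, so it
  suffices to minimise over those. The infimum of a nonempty set of natural numbers is its minimum.
  The set is empty only if some edgeless member of the family has at most \<open>n\<close> vertices; then the
  minimum is undefined and the value here is \<open>0\<close>. A lower bound \<open>\<Omega>(n^(r-1))\<close> along the odd \<open>n\<close>
  rules out edgeless members altogether.\<close>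

definition sat :: "nat \<Rightarrow> 'b hypergraph set \<Rightarrow> nat \<Rightarrow> nat" where
  "sat r \<F> n =
     Inf {card (edges H) | H :: nat hypergraph. card (verts H) = n \<and> saturated r \<F> H}"

end

theory Submission
  imports Defs
begin

text \<open>
  The construction uses two connected \<open>r\<close>-graphs, the blocks: the complete \<open>r\<close>-graph on \<open>2r\<close>
  vertices, and the \<open>r\<close>-graph on two disjoint parts of size \<open>r + 1\<close> whose edges are the \<open>r\<close>-sets
  meeting both parts. Their orders \<open>2r\<close> and \<open>2r + 2\<close> are even and every large even number is a
  sum of copies of them. Neither block contains the other, since every \<open>2r\<close>-set of the second has at least
  \<open>r\<close> vertices in one part. Moreover, each \<open>(r-1)\<close>-subset of an edge of a block also lies in
  another edge of that block (\<open>block_cover\<close>).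

  The family consists of the \<open>r\<close>-graphs of bounded order in which every vertex lies in a block,
  but some block is not isolated, that is, meets an edge that does not belong to it.

  For large even \<open>n\<close>, some disjoint union of blocks has \<open>n\<close> vertices and \<open>O(n)\<close> edges. By
  connectivity and incomparability the only blocks in it are the given ones, and they are isolated, so
  no member of the family occurs. Adding an edge \<open>e\<close> creates one: take the blocks that meet
  \<open>e\<close>, together with \<open>e\<close> (\<open>tiled_saturated\<close>).

  Conversely, let \<open>H\<close> be saturated of odd order. Two distinct blocks of \<open>H\<close> that overlap would
  form a member of the family, so the blocks of \<open>H\<close> are disjoint and, by parity, miss some vertex
  \<open>v\<close>. Let \<open>T\<close> be an \<open>(r-1)\<close>-set avoiding \<open>v\<close>. If \<open>T \<union> {v}\<close> is not an edge, adding it creates a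
  copy of a member of the family. In this copy \<open>v\<close> lies in a block, and that block has to use
  the new edge; hence \<open>T\<close> lies in another edge of the block, which is an edge of \<open>H\<close>
  (\<open>shadow_covered\<close>). So all \<open>(r-1)\<close>-sets avoiding \<open>v\<close> are covered by edges of \<open>H\<close>, and there
  are \<open>\<Omega>(n^(r-1))\<close> edges.
\<close>

section \<open>Blocks\<close>

definition subgraph :: "'a hypergraph \<Rightarrow> 'a hypergraph \<Rightarrow> bool" where
  "subgraph B H \<longleftrightarrow> verts B \<subseteq> verts H \<and> edges B \<subseteq> edges H"

definition image_graph :: "('a \<Rightarrow> 'b) \<Rightarrow> 'a hypergraph \<Rightarrow> 'b hypergraph" where
  "image_graph \<phi> H = (\<phi> ` verts H, (`) \<phi> ` edges H)"

text \<open>The \<open>r\<close>-subsets of \<open>P \<union> Q\<close> that meet both \<open>P\<close> and \<open>Q\<close>.\<close>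

definition crossing_sets :: "nat \<Rightarrow> 'a set \<Rightarrow> 'a set \<Rightarrow> 'a set set" where
  "crossing_sets r P Q = {e. e \<subseteq> P \<union> Q \<and> card e = r \<and> e \<inter> P \<noteq> {} \<and> e \<inter> Q \<noteq> {}}"

text \<open>The two kinds of blocks are described intrinsically, not as copies of fixed \<open>r\<close>-graphs, so
  that they can be recognised over any vertex type. The condition on the cardinality of the vertex
  set (or of the parts) forces it to be finite for \<open>r \<ge> 1\<close>, because infinite sets have cardinality 0.\<close>

definition complete_block :: "nat \<Rightarrow> 'a hypergraph \<Rightarrow> bool" where
  "complete_block r B \<longleftrightarrow>
     card (verts B) = 2 * r \<and> edges B = {e. e \<subseteq> verts B \<and> card e = r}"

definition crossing_block :: "nat \<Rightarrow> 'a hypergraph \<Rightarrow> bool" where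
  "crossing_block r B \<longleftrightarrow>
     (\<exists>P Q. P \<inter> Q = {} \<and> card P = r + 1 \<and> card Q = r + 1 \<and>
        verts B = P \<union> Q \<and> edges B = crossing_sets r P Q)"

definition block :: "nat \<Rightarrow> 'a hypergraph \<Rightarrow> bool" where
  "block r B \<longleftrightarrow> complete_block r B \<or> crossing_block r B"

text \<open>\<open>B\<close> is isolated in \<open>G\<close> if every edge of \<open>G\<close> meeting the vertex set of \<open>B\<close> is an edge of
  \<open>B\<close>. For an \<open>r\<close>-graph \<open>B\<close> contained in \<open>G\<close> this says that \<open>B\<close> is a union of components
  of \<open>G\<close>.\<close>

definition isolated :: "'a hypergraph \<Rightarrow> 'a hypergraph \<Rightarrow> bool" where
  "isolated B G \<longleftrightarrow> (\<forall>f\<in>edges G. f \<inter> verts B \<noteq> {} \<longrightarrow> f \<in> edges B)"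

lemma crossing_sets_commute: "crossing_sets r P Q = crossing_sets r Q P"
  unfolding crossing_sets_def by auto

lemma contains_copy_iff_image:
  "contains_copy H F \<longleftrightarrow> (\<exists>\<phi>. inj_on \<phi> (verts F) \<and> subgraph (image_graph \<phi> F) H)"
  unfolding contains_copy_def subgraph_def image_graph_def by (simp add: image_subset_iff)

lemma subgraph_trans: "subgraph A B \<Longrightarrow> subgraph B C \<Longrightarrow> subgraph A C"
  unfolding subgraph_def by auto

lemma subgraph_image: "subgraph B G \<Longrightarrow> subgraph (image_graph \<phi> B) (image_graph \<phi> G)"
  unfolding subgraph_def image_graph_def by auto

lemma verts_image_graph [simp]: "verts (image_graph \<phi> B) = \<phi> ` verts B"
  unfolding image_graph_def by simp

lemma edges_image_graph [simp]: "edges (image_graph \<phi> B) = (`) \<phi> ` edges B"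
  unfolding image_graph_def by simp

lemma card_verts_complete_block: "complete_block r B \<Longrightarrow> card (verts B) = 2 * r"
  unfolding complete_block_def by auto

lemma card_verts_crossing_block:
  assumes "crossing_block r B" shows "card (verts B) = 2 * r + 2"
proof -
  obtain P Q where "P \<inter> Q = {}" "card P = r + 1" "card Q = r + 1" "verts B = P \<union> Q"
    using assms unfolding crossing_block_def by auto
  moreover from this have "finite P" "finite Q" by (auto intro: card_ge_0_finite)
  ultimately show ?thesis by (simp add: card_Un_disjoint)
qed

lemma even_card_verts_block: "block r B \<Longrightarrow> even (card (verts B))"
  unfolding block_def using card_verts_complete_block card_verts_crossing_block by fastforce

lemma card_verts_block_le: "block r B \<Longrightarrow> card (verts B) \<le> 2 * r + 2"
  unfolding block_def using card_verts_complete_block card_verts_crossing_block by fastforce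

lemma finite_verts_block:
  assumes "r \<ge> 2" "block r B" shows "finite (verts B)"
proof -
  have "card (verts B) > 0"
    using assms card_verts_complete_block[of r B] card_verts_crossing_block[of r B]
    unfolding block_def by auto
  then show ?thesis by (rule card_ge_0_finite)
qed

lemma block_edge:
  assumes "block r B" "e \<in> edges B" shows "e \<subseteq> verts B" "card e = r"
  using assms unfolding block_def complete_block_def crossing_block_def crossing_sets_def by auto

lemma r_graph_block: "r \<ge> 2 \<Longrightarrow> block r B \<Longrightarrow> r_graph r B"
  unfolding r_graph_def using finite_verts_block block_edge by blast

lemma card_edges_block_le:
  assumes "r \<ge> 2" "block r B" shows "card (edges B) \<le> 2 ^ (2 * r + 2)"
proof -
  have "card (edges B) \<le> card (Pow (verts B))"
    using assms finite_verts_block block_edge(1) by (intro card_mono) blast+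
  also have "\<dots> = 2 ^ card (verts B)" using finite_verts_block[OF assms] by (simp add: card_Pow)
  also have "\<dots> \<le> 2 ^ (2 * r + 2)" using card_verts_block_le[OF assms(2)] by (intro power_increasing) auto
  finally show ?thesis .
qed

lemma image_fixed_card_subsets:
  assumes "inj_on \<phi> V"
  shows "(`) \<phi> ` {e. e \<subseteq> V \<and> card e = r \<and> R (\<phi> ` e)} = {e. e \<subseteq> \<phi> ` V \<and> card e = r \<and> R e}"
proof (intro equalityI subsetI)
  fix e assume "e \<in> (`) \<phi> ` {e. e \<subseteq> V \<and> card e = r \<and> R (\<phi> ` e)}"
  then show "e \<in> {e. e \<subseteq> \<phi> ` V \<and> card e = r \<and> R e}"
    using assms by (auto intro: card_image inj_on_subset)
next
  fix e assume e: "e \<in> {e. e \<subseteq> \<phi> ` V \<and> card e = r \<and> R e}"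
  then obtain d where "d \<subseteq> V" "e = \<phi> ` d" by (auto simp: subset_image_iff)
  moreover from this have "card d = card e" using assms by (metis card_image inj_on_subset)
  ultimately show "e \<in> (`) \<phi> ` {e. e \<subseteq> V \<and> card e = r \<and> R (\<phi> ` e)}" using e by auto
qed

lemma complete_block_image:
  assumes "inj_on \<phi> (verts B)" "complete_block r B"
  shows "complete_block r (image_graph \<phi> B)"
  using assms image_fixed_card_subsets[OF assms(1), of r "\<lambda>_. True"]
  unfolding complete_block_def by (auto simp: card_image)

lemma crossing_block_image:
  assumes inj: "inj_on \<phi> (verts B)" and "crossing_block r B"
  shows "crossing_block r (image_graph \<phi> B)"
proof -
  obtain P Q where PQ: "P \<inter> Q = {}" "card P = r + 1" "card Q = r + 1"
      "verts B = P \<union> Q" "edges B = crossing_sets r P Q"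
    using assms unfolding crossing_block_def by auto
  let ?R = "\<lambda>e. e \<inter> \<phi> ` P \<noteq> {} \<and> e \<inter> \<phi> ` Q \<noteq> {}"
  have inj': "inj_on \<phi> (P \<union> Q)" using inj PQ by simp
  have "crossing_sets r P Q = {e. e \<subseteq> P \<union> Q \<and> card e = r \<and> ?R (\<phi> ` e)}"
    unfolding crossing_sets_def
  proof (intro Collect_cong conj_cong refl)
    fix e assume e: "e \<subseteq> P \<union> Q"
    have "(\<phi> ` e) \<inter> \<phi> ` P = \<phi> ` (e \<inter> P)" "(\<phi> ` e) \<inter> \<phi> ` Q = \<phi> ` (e \<inter> Q)"
      using inj_on_image_Int[OF inj'] e by auto
    then show "(e \<inter> P \<noteq> {}) = (\<phi> ` e \<inter> \<phi> ` P \<noteq> {})" "(e \<inter> Q \<noteq> {}) = (\<phi> ` e \<inter> \<phi> ` Q \<noteq> {})"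
      by auto
  qed
  then have "(`) \<phi> ` crossing_sets r P Q = crossing_sets r (\<phi> ` P) (\<phi> ` Q)"
    using image_fixed_card_subsets[OF inj', of r ?R] unfolding crossing_sets_def
    by (simp add: image_Un)
  moreover have "\<phi> ` P \<inter> \<phi> ` Q = {}" using inj_on_image_Int[OF inj', of P Q] PQ by auto
  moreover have "card (\<phi> ` P) = r + 1" "card (\<phi> ` Q) = r + 1"
    using PQ inj' by (simp_all add: card_image inj_on_Un)
  ultimately show ?thesis
    unfolding crossing_block_def using PQ
    by (intro exI[of _ "\<phi> ` P"] exI[of _ "\<phi> ` Q"]) (simp add: image_Un)
qed

lemma block_image:
  "inj_on \<phi> (verts B) \<Longrightarrow> block r B \<Longrightarrow> block r (image_graph \<phi> B)"
  unfolding block_def using complete_block_image crossing_block_image by blast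

lemma crossing_set_through_pair:
  assumes "r \<ge> 2" "p \<in> P" "q \<in> Q" "P \<inter> Q = {}" "finite P" "finite Q" "card (P \<union> Q) \<ge> r"
  obtains e where "e \<in> crossing_sets r P Q" "p \<in> e" "q \<in> e"
proof -
  have "p \<noteq> q" using assms by auto
  then obtain e where "{p, q} \<subseteq> e" "e \<subseteq> P \<union> Q" "card e = r"
    using exists_subset_between[of "{p, q}" r "P \<union> Q"] assms by auto
  then show ?thesis using assms that[of e] unfolding crossing_sets_def by auto
qed

text \<open>Blocks are connected: a set that contains every edge it meets contains the block or is
  disjoint from it.\<close>

lemma block_connected:
  assumes r: "r \<ge> 2" and B: "block r B"
    and closed: "\<And>f. f \<in> edges B \<Longrightarrow> f \<inter> S \<noteq> {} \<Longrightarrow> f \<subseteq> S"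
    and meets: "verts B \<inter> S \<noteq> {}"
  shows "verts B \<subseteq> S"
proof -
  have fin: "finite (verts B)" using finite_verts_block r B .
  consider "complete_block r B" | "crossing_block r B" using B unfolding block_def by auto
  then show ?thesis
  proof cases
    case 1
    obtain s where s: "s \<in> verts B" "s \<in> S" using meets by auto
    show ?thesis
    proof
      fix w assume w: "w \<in> verts B"
      have "card {s, w} \<le> r" using r by (simp add: card_insert_if)
      then obtain e where "{s, w} \<subseteq> e" "e \<subseteq> verts B" "card e = r"
        using exists_subset_between[of "{s, w}" r "verts B"] s w fin 1
        unfolding complete_block_def by auto
      then show "w \<in> S" using closed[of e] 1 s unfolding complete_block_def by auto
    qed
  next
    case 2
    then obtain P Q where PQ: "P \<inter> Q = {}" "card P = r + 1" "card Q = r + 1"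
        "verts B = P \<union> Q" "edges B = crossing_sets r P Q"
      unfolding crossing_block_def by auto
    have card: "card (P \<union> Q) \<ge> r" using card_verts_crossing_block[OF 2] PQ by simp
    have pair: "p \<in> S \<longleftrightarrow> q \<in> S" if "p \<in> P" "q \<in> Q" for p q
    proof -
      obtain e where "e \<in> edges B" "p \<in> e" "q \<in> e"
        using crossing_set_through_pair[OF r \<open>p \<in> P\<close> \<open>q \<in> Q\<close> PQ(1) _ _ card] fin PQ by auto
      then show ?thesis using closed[of e] by auto
    qed
    have "P \<noteq> {}" "Q \<noteq> {}" using PQ by auto
    then show ?thesis using pair meets PQ by blast
  qed
qed

text \<open>The property of blocks behind the lower bound.\<close>

lemma block_cover:
  assumes r: "r \<ge> 2" and B: "block r B" and e: "e \<in> edges B" and v: "v \<in> e"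
  obtains g where "g \<in> edges B" "g \<noteq> e" "e - {v} \<subseteq> g"
proof -
  have fin: "finite (verts B)" using finite_verts_block r B .
  have eV: "e \<subseteq> verts B" "card e = r" using block_edge[OF B e] by auto
  have fe: "finite e" using fin eV finite_subset by auto
  have card: "card (e - {v}) = r - 1" using eV fe v by simp
  have swap: "card (insert x (e - {v})) = r" "insert x (e - {v}) \<noteq> e" if "x \<notin> e" for x
    using that card fe r by (auto simp: card_insert_if)
  consider "complete_block r B" | "crossing_block r B" using B unfolding block_def by auto
  then show ?thesis
  proof cases
    case 1
    have "\<not> verts B \<subseteq> e"
      using card_mono[OF fe, of "verts B"] eV 1 r unfolding complete_block_def by auto
    then obtain x where x: "x \<in> verts B" "x \<notin> e" by auto
    then have "insert x (e - {v}) \<in> edges B"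
      using 1 eV swap unfolding complete_block_def by auto
    then show ?thesis using that[of "insert x (e - {v})"] swap x by auto
  next
    case 2
    have extend: "\<exists>g\<in>edges B. g \<noteq> e \<and> e - {v} \<subseteq> g"
      if PQ: "P \<inter> Q = {}" "card Q = r + 1" "verts B = P \<union> Q" "edges B = crossing_sets r P Q"
        and w: "w \<in> e - {v}" "w \<in> P" for P Q w
    proof -
      have "\<not> Q \<subseteq> e" using card_mono[OF fe, of Q] eV PQ by auto
      then obtain x where x: "x \<in> Q" "x \<notin> e" by auto
      then have "insert x (e - {v}) \<in> edges B"
        using PQ eV swap[OF x(2)] w unfolding crossing_sets_def by auto
      then show ?thesis using swap(2)[OF x(2)] by (intro bexI[of _ "insert x (e - {v})"]) auto
    qed
    obtain P Q where PQ: "P \<inter> Q = {}" "card P = r + 1" "card Q = r + 1"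
        "verts B = P \<union> Q" "edges B = crossing_sets r P Q"
      using 2 unfolding crossing_block_def by auto
    have "card (e - {v}) \<noteq> 0" using card r by simp
    then have "e - {v} \<noteq> {}" by (metis card.empty)
    then obtain w where w: "w \<in> e - {v}" by blast
    then consider "w \<in> P" | "w \<in> Q" using eV PQ by auto
    then have "\<exists>g\<in>edges B. g \<noteq> e \<and> e - {v} \<subseteq> g"
    proof cases
      case 1
      show ?thesis by (rule extend[of P Q w]) (use PQ w 1 in auto)
    next
      case 2
      show ?thesis
        by (rule extend[of Q P w]) (use PQ w 2 in \<open>auto simp: crossing_sets_commute[of r P]\<close>)
    qed
    then show ?thesis using that by blast
  qed
qed

text \<open>The two parts can be read off from the crossing sets. If \<open>P\<close> met both \<open>P'\<close> and
  \<open>Q'\<close>, some \<open>r\<close>-subset of \<open>P\<close> would cross between \<open>P'\<close> and \<open>Q'\<close> but not between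
  \<open>P\<close> and \<open>Q\<close>.\<close>

lemma crossing_part_eq:
  assumes r: "r \<ge> 2" and PQ: "P \<inter> Q = {}" "card P = r + 1" "card Q = r + 1"
    and PQ': "P' \<inter> Q' = {}" "card P' = r + 1" "card Q' = r + 1"
    and eq: "P \<union> Q = P' \<union> Q'" and sub: "crossing_sets r P' Q' \<subseteq> crossing_sets r P Q"
  shows "P = P' \<or> P = Q'"
proof -
  have fin: "finite P" "finite P'" "finite Q'" using PQ PQ' by (auto intro: card_ge_0_finite)
  have "P \<inter> P' = {} \<or> P \<inter> Q' = {}"
  proof (rule ccontr)
    assume "\<not> ?thesis"
    then obtain p q where pq: "p \<in> P \<inter> P'" "q \<in> P \<inter> Q'" by auto
    have "card ((P \<inter> P') \<union> (P \<inter> Q')) \<ge> r"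
    proof -
      have "(P \<inter> P') \<union> (P \<inter> Q') = P" using eq by auto
      then show ?thesis using PQ by simp
    qed
    then obtain e where "e \<in> crossing_sets r (P \<inter> P') (P \<inter> Q')"
      using crossing_set_through_pair[OF r pq] PQ' fin by blast
    then have "e \<in> crossing_sets r P' Q'" "e \<notin> crossing_sets r P Q"
      using PQ unfolding crossing_sets_def by auto
    then show False using sub by auto
  qed
  then have "P \<subseteq> Q' \<or> P \<subseteq> P'" using eq by auto
  then show ?thesis using card_subset_eq fin PQ PQ' by metis
qed

text \<open>Blocks are pairwise incomparable.\<close>

lemma block_subgraph_eq:
  assumes r: "r \<ge> 2" and B: "block r B" and C: "block r C" and sub: "subgraph B C"
  shows "B = C"
proof -
  have fin: "finite (verts C)" "finite (verts B)" using finite_verts_block[OF r] B C by blast+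
  have le: "card (verts B) \<le> card (verts C)"
    using sub fin unfolding subgraph_def by (auto intro: card_mono)
  have same: "verts B = verts C" if "card (verts B) = card (verts C)"
    using that sub card_subset_eq[OF fin(1)] unfolding subgraph_def by blast
  consider "complete_block r B" "complete_block r C" | "crossing_block r B" "complete_block r C"
    | "complete_block r B" "crossing_block r C" | "crossing_block r B" "crossing_block r C"
    using B C unfolding block_def by auto
  then show ?thesis
  proof cases
    case 1
    then show ?thesis using same unfolding complete_block_def by (auto intro: prod_eqI)
  next
    case 2
    then show ?thesis using le card_verts_complete_block card_verts_crossing_block by fastforce
  next
    case 3
    then obtain P Q where PQ: "P \<inter> Q = {}" "verts C = P \<union> Q" "edges C = crossing_sets r P Q"
      unfolding crossing_block_def by auto
    \<comment> \<open>One of the two parts contains \<open>r\<close> of the \<open>2r\<close> vertices of \<open>B\<close>; these form an edge of \<open>B\<close>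
      that does not cross.\<close>
    have "verts B = (verts B \<inter> P) \<union> (verts B \<inter> Q)" using sub PQ unfolding subgraph_def by auto
    then have "2 * r = card (verts B \<inter> P) + card (verts B \<inter> Q)"
      using card_Un_disjoint[of "verts B \<inter> P" "verts B \<inter> Q"] fin PQ 3
      unfolding complete_block_def by auto
    then consider "r \<le> card (verts B \<inter> P)" | "r \<le> card (verts B \<inter> Q)" by linarith
    then obtain e where e: "card e = r" "e \<subseteq> verts B" "e \<subseteq> P \<or> e \<subseteq> Q"
      by (metis obtain_subset_with_card_n le_inf_iff)
    then have "e \<in> edges B" using 3 unfolding complete_block_def by auto
    then have "e \<in> crossing_sets r P Q" using sub PQ unfolding subgraph_def by auto
    then show ?thesis using e PQ unfolding crossing_sets_def by auto
  next
    case 4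
    obtain P Q where PQ: "P \<inter> Q = {}" "card P = r + 1" "card Q = r + 1"
        "verts C = P \<union> Q" "edges C = crossing_sets r P Q"
      using 4 unfolding crossing_block_def by auto
    obtain P' Q' where PQ': "P' \<inter> Q' = {}" "card P' = r + 1" "card Q' = r + 1"
        "verts B = P' \<union> Q'" "edges B = crossing_sets r P' Q'"
      using 4 unfolding crossing_block_def by auto
    have V: "verts B = verts C" using same 4 card_verts_crossing_block by metis
    then have U: "P \<union> Q = P' \<union> Q'" using PQ PQ' by simp
    have "crossing_sets r P' Q' \<subseteq> crossing_sets r P Q"
      using sub PQ PQ' unfolding subgraph_def by simp
    then have "P = P' \<or> P = Q'" using crossing_part_eq[OF r PQ(1-3) PQ'(1-3) U] by simp
    moreover have "Q = (P' \<union> Q') - P" "P' = (P' \<union> Q') - Q'" "Q' = (P' \<union> Q') - P'"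
      using U PQ(1) PQ'(1) by auto
    ultimately have "P = P' \<and> Q = Q' \<or> P = Q' \<and> Q = P'" by metis
    then have "edges B = edges C" using PQ(5) PQ'(5) crossing_sets_commute[of r P Q] by metis
    with V show ?thesis by (simp add: prod_eqI)
  qed
qed

lemma isolated_block_absorbs:
  assumes r: "r \<ge> 2" and B: "block r B" "isolated B G"
    and C: "block r C" "subgraph C G" and meet: "verts B \<inter> verts C \<noteq> {}"
  shows "subgraph C B"
proof -
  have BG: "f \<in> edges B" if "f \<in> edges C" "f \<inter> verts B \<noteq> {}" for f
    using that B C unfolding isolated_def subgraph_def by auto
  then have "verts C \<subseteq> verts B"
    using block_connected[OF r C(1), of "verts B"] block_edge(1)[OF B(1)] meet by blast
  moreover have "edges C \<subseteq> edges B"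
  proof
    fix f assume f: "f \<in> edges C"
    then have "f \<subseteq> verts C" "f \<noteq> {}" using block_edge[OF C(1) f] r by auto
    then show "f \<in> edges B" using BG[OF f] \<open>verts C \<subseteq> verts B\<close> by auto
  qed
  ultimately show ?thesis unfolding subgraph_def by simp
qed

section \<open>The forbidden family\<close>

text \<open>An \<open>r\<close>-graph is tiled if it is a vertex-disjoint union of blocks; equivalently, every
  vertex lies in an isolated block.\<close>

definition tiled :: "nat \<Rightarrow> 'a hypergraph \<Rightarrow> bool" where
  "tiled r H \<longleftrightarrow> r_graph r H \<and>
     (\<forall>v\<in>verts H. \<exists>B. block r B \<and> subgraph B H \<and> isolated B H \<and> v \<in> verts B)"

text \<open>An obstruction is covered by its blocks but is not tiled by them. No bound on the number of
  vertices is imposed here.\<close>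

definition obstruction :: "nat \<Rightarrow> 'a hypergraph \<Rightarrow> bool" where
  "obstruction r G \<longleftrightarrow> r_graph r G \<and>
     (\<forall>v\<in>verts G. \<exists>B. block r B \<and> subgraph B G \<and> v \<in> verts B) \<and>
     (\<exists>B. block r B \<and> subgraph B G \<and> \<not> isolated B G)"

text \<open>The family itself. The bound on the order leaves room for \<open>r\<close> blocks, since an added edge
  can meet that many blocks of a tiled \<open>r\<close>-graph. Fixing the vertex labels makes the family
  finite.\<close>

definition obstructions :: "nat \<Rightarrow> nat hypergraph set" where
  "obstructions r = {F. obstruction r F \<and> verts F \<subseteq> {..<r * (2 * r + 2)}}"

lemma obstruction_image:
  assumes inj: "inj_on \<phi> (verts G)" and G: "obstruction r G"
  shows "obstruction r (image_graph \<phi> G)"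
proof -
  have rG: "r_graph r G" using G unfolding obstruction_def by simp
  have img: "block r (image_graph \<phi> B)" "subgraph (image_graph \<phi> B) (image_graph \<phi> G)"
    if "block r B" "subgraph B G" for B
    using that block_image[of \<phi> B r] subgraph_image[of B G \<phi>] inj_on_subset[OF inj]
    unfolding subgraph_def by blast+
  have "r_graph r (image_graph \<phi> G)"
    using rG inj unfolding r_graph_def by (auto intro!: card_image intro: inj_on_subset)
  moreover have "\<exists>B. block r B \<and> subgraph B (image_graph \<phi> G) \<and> w \<in> verts B"
    if w: "w \<in> verts (image_graph \<phi> G)" for w
  proof -
    obtain v where "v \<in> verts G" "w = \<phi> v" using w by auto
    moreover from this obtain B where "block r B" "subgraph B G" "v \<in> verts B"
      using G unfolding obstruction_def by auto
    ultimately show ?thesis using img[of B] by (intro exI[of _ "image_graph \<phi> B"]) auto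
  qed
  moreover have "\<exists>B. block r B \<and> subgraph B (image_graph \<phi> G) \<and> \<not> isolated B (image_graph \<phi> G)"
  proof -
    obtain B f where B: "block r B" "subgraph B G" and f: "f \<in> edges G" "f \<inter> verts B \<noteq> {}" "f \<notin> edges B"
      using G unfolding obstruction_def isolated_def by blast
    have "\<phi> ` f \<notin> (`) \<phi> ` edges B"
    proof
      assume "\<phi> ` f \<in> (`) \<phi> ` edges B"
      then obtain g where g: "g \<in> edges B" "\<phi> ` f = \<phi> ` g" by auto
      have "g \<subseteq> verts G" "f \<subseteq> verts G"
        using g f rG B unfolding r_graph_def subgraph_def by auto
      then have "f = g" using g inj by (simp add: inj_on_image_eq_iff)
      then show False using f g by simp
    qed
    then have "\<not> isolated (image_graph \<phi> B) (image_graph \<phi> G)"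
      using f unfolding isolated_def by auto
    then show ?thesis using img[OF B] by blast
  qed
  ultimately show ?thesis unfolding obstruction_def by blast
qed

text \<open>A small obstruction over any vertex type can be relabelled as a member of the family.\<close>

lemma contains_obstruction:
  assumes G: "obstruction r G" and sub: "subgraph G H" and card: "card (verts G) \<le> r * (2 * r + 2)"
  obtains F where "F \<in> obstructions r" "contains_copy H F"
proof -
  have rG: "r_graph r G" using G unfolding obstruction_def by simp
  then have "finite (verts G)" unfolding r_graph_def by simp
  then obtain \<psi> where \<psi>: "bij_betw \<psi> (verts G) {0..<card (verts G)}"
    using ex_bij_betw_finite_nat by blast
  define F where "F = image_graph \<psi> G"
  define \<phi> where "\<phi> = inv_into (verts G) \<psi>"
  have inj: "inj_on \<psi> (verts G)" using \<psi> unfolding bij_betw_def by simp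
  have "obstruction r F" unfolding F_def using obstruction_image[OF inj G] .
  moreover have "verts F \<subseteq> {..<r * (2 * r + 2)}"
    using \<psi> card unfolding F_def bij_betw_def by auto
  moreover have "inj_on \<phi> (verts F)"
    unfolding F_def \<phi>_def by (simp add: inj_on_inv_into)
  moreover have "image_graph \<phi> F = G"
  proof -
    have restore: "\<phi> ` \<psi> ` e = e" if "e \<subseteq> verts G" for e
      unfolding \<phi>_def using inj that by (rule inv_into_image_cancel)
    have "(\<lambda>e. \<phi> ` \<psi> ` e) ` edges G = edges G"
      using restore rG unfolding r_graph_def by (auto simp: image_iff)
    then show ?thesis
      unfolding F_def using restore[of "verts G"] by (intro prod_eqI) (simp_all add: image_image)
  qed
  ultimately show ?thesis
    using sub that[of F] unfolding obstructions_def contains_copy_iff_image by auto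
qed

lemma finite_obstructions: "finite (obstructions r)"
proof (rule finite_subset)
  let ?N = "{..<r * (2 * r + 2)}"
  show "obstructions r \<subseteq> Pow ?N \<times> Pow (Pow ?N)"
    unfolding obstructions_def obstruction_def r_graph_def by fastforce
qed auto

section \<open>Disjoint unions of blocks are saturated\<close>

lemma block_of_tiled_isolated:
  assumes r: "r \<ge> 2" and H: "tiled r H" and C: "block r C" "subgraph C H"
  shows "isolated C H"
proof -
  have "verts C \<noteq> {}"
    using C(1) r card_verts_complete_block[of r C] card_verts_crossing_block[of r C]
    unfolding block_def by auto
  then obtain v where v: "v \<in> verts C" "v \<in> verts H" using C unfolding subgraph_def by auto
  then obtain B where B: "block r B" "subgraph B H" "isolated B H" "v \<in> verts B"
    using H unfolding tiled_def by auto
  have "subgraph C B"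
    using isolated_block_absorbs[OF r B(1,3) C] v B(4) by auto
  then have "C = B" using block_subgraph_eq r C B by blast
  then show ?thesis using B by simp
qed

lemma obstruction_not_in_tiled:
  assumes r: "r \<ge> 2" and H: "tiled r H" and G: "obstruction r G"
  shows "\<not> contains_copy H G"
proof
  assume "contains_copy H G"
  then obtain \<phi> where \<phi>: "inj_on \<phi> (verts G)" "subgraph (image_graph \<phi> G) H"
    unfolding contains_copy_iff_image by auto
  then have "obstruction r (image_graph \<phi> G)" using obstruction_image G by blast
  then obtain B where B: "block r B" "subgraph B (image_graph \<phi> G)" "\<not> isolated B (image_graph \<phi> G)"
    unfolding obstruction_def by auto
  then have "isolated B H" using block_of_tiled_isolated[OF r H] \<phi> subgraph_trans by blast
  then show False using B(3) \<phi>(2) unfolding isolated_def subgraph_def by blast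
qed

lemma tiled_saturated:
  assumes r: "r \<ge> 2" and H: "tiled r H"
  shows "saturated r (obstructions r) H"
  unfolding saturated_def
proof (intro conjI allI impI ballI)
  show rH: "r_graph r H" using H unfolding tiled_def by simp
  show "\<not> contains_copy H F" if "F \<in> obstructions r" for F
    using that obstruction_not_in_tiled[OF r H, of F] unfolding obstructions_def by blast
  fix e assume e: "e \<subseteq> verts H \<and> card e = r \<and> e \<notin> edges H"
  have fe: "finite e" using e r by (auto intro: card_ge_0_finite)
  have "\<forall>v\<in>e. \<exists>B. block r B \<and> subgraph B H \<and> v \<in> verts B"
    using H e unfolding tiled_def by blast
  then obtain b where b: "\<And>v. v \<in> e \<Longrightarrow> block r (b v) \<and> subgraph (b v) H \<and> v \<in> verts (b v)"
    by metis
  \<comment> \<open>The blocks meeting the new edge \<open>e\<close>, together with \<open>e\<close>, form an obstruction.\<close>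
  define G where "G = (\<Union>v\<in>e. verts (b v), insert e (\<Union>v\<in>e. edges (b v)))"
  have sub: "subgraph (b v) G" if "v \<in> e" for v
    using that unfolding subgraph_def G_def by auto
  have "obstruction r G"
    unfolding obstruction_def
  proof (intro conjI)
    show "r_graph r G"
      unfolding r_graph_def
    proof (intro conjI ballI)
      show "finite (verts G)" unfolding G_def using fe b finite_verts_block[OF r] by simp blast
      fix f assume "f \<in> edges G"
      then consider "f = e" | v where "v \<in> e" "f \<in> edges (b v)" unfolding G_def by auto
      then have "f \<subseteq> verts G \<and> card f = r"
      proof cases
        case 1
        then show ?thesis using e b unfolding G_def by auto
      next
        case 2
        then have "f \<subseteq> verts (b v)" "card f = r" using b block_edge by blast+
        then show ?thesis using sub[OF 2(1)] unfolding subgraph_def by blast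
      qed
      then show "f \<subseteq> verts G" "card f = r" by auto
    qed
    show "\<forall>v\<in>verts G. \<exists>B. block r B \<and> subgraph B G \<and> v \<in> verts B"
    proof
      fix w assume "w \<in> verts G"
      then obtain v where "v \<in> e" "w \<in> verts (b v)" unfolding G_def by auto
      then show "\<exists>B. block r B \<and> subgraph B G \<and> w \<in> verts B" using b sub by blast
    qed
    obtain v where v: "v \<in> e" using e r by fastforce
    have "e \<notin> edges (b v)" using b[OF v] e unfolding subgraph_def by auto
    then have "\<not> isolated (b v) G" using b[OF v] v unfolding isolated_def G_def by auto
    then show "\<exists>B. block r B \<and> subgraph B G \<and> \<not> isolated B G" using b[OF v] sub[OF v] by blast
  qed
  moreover have "subgraph G (verts H, insert e (edges H))"
    using b e unfolding G_def subgraph_def by simp blast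
  moreover have "card (verts G) \<le> r * (2 * r + 2)"
  proof -
    have "card (verts G) \<le> (\<Sum>v\<in>e. card (verts (b v)))"
      unfolding G_def using card_UN_le[OF fe] by simp
    also have "\<dots> \<le> (\<Sum>v\<in>e. 2 * r + 2)"
      using b card_verts_block_le by (intro sum_mono) blast
    finally show ?thesis using e by simp
  qed
  ultimately show "\<exists>F\<in>obstructions r. contains_copy (verts H, insert e (edges H)) F"
    using contains_obstruction by blast
qed

section \<open>The upper bound for even orders\<close>

lemma tiled_add_block:
  assumes r: "r \<ge> 2" and H: "tiled r H" and B: "block r B" and disj: "verts H \<inter> verts B = {}"
  shows "tiled r (verts H \<union> verts B, edges H \<union> edges B)" (is "tiled r ?K")
proof -
  have rH: "r_graph r H" using H unfolding tiled_def by simp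
  have rB: "r_graph r B" using r_graph_block r B .
  have sub: "subgraph H ?K" "subgraph B ?K" unfolding subgraph_def by auto
  have "r_graph r ?K" using rH rB unfolding r_graph_def by auto
  moreover have "isolated B ?K"
    using rH disj unfolding isolated_def r_graph_def by auto
  moreover have "isolated C ?K" if "isolated C H" "subgraph C H" for C
    using that rB disj unfolding isolated_def r_graph_def subgraph_def by simp blast
  moreover have "\<exists>C. block r C \<and> subgraph C ?K \<and> isolated C ?K \<and> v \<in> verts C"
    if "v \<in> verts ?K" for v
  proof (cases "v \<in> verts H")
    case True
    then obtain C where "block r C" "subgraph C H" "isolated C H" "v \<in> verts C"
      using H unfolding tiled_def by blast
    then show ?thesis using calculation(3) subgraph_trans[OF _ sub(1)] by blast
  next
    case False
    then have "v \<in> verts B" using that by simp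
    then show ?thesis using B sub(2) calculation(2) by blast
  qed
  ultimately show ?thesis unfolding tiled_def by blast
qed

text \<open>\<open>tileable r n\<close>: there is a disjoint union of blocks on the vertex set \<open>{..<n}\<close> with a
  linear number of edges. The constant \<open>2 ^ (2 * r + 2)\<close> bounds the number of edges of a single
  block.\<close>

definition tileable :: "nat \<Rightarrow> nat \<Rightarrow> bool" where
  "tileable r n \<longleftrightarrow> (\<exists>H :: nat hypergraph.
     verts H = {..<n} \<and> tiled r H \<and> card (edges H) \<le> 2 ^ (2 * r + 2) * n)"

lemma tileable_add_block:
  assumes r: "r \<ge> 2" and n: "tileable r n" and B: "block r B" "verts B = {n..<n + k}" "k \<ge> 1"
  shows "tileable r (n + k)"
proof -
  obtain H :: "nat hypergraph" where H: "verts H = {..<n}" "tiled r H" 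
      "card (edges H) \<le> 2 ^ (2 * r + 2) * n"
    using n unfolding tileable_def by auto
  let ?K = "(verts H \<union> verts B, edges H \<union> edges B)"
  have "tiled r ?K" using H(1) B(2) by (intro tiled_add_block[OF r H(2) B(1)]) auto
  moreover have "verts ?K = {..<n + k}" using H B by auto
  moreover have "card (edges ?K) \<le> 2 ^ (2 * r + 2) * (n + k)"
  proof -
    have "card (edges ?K) \<le> card (edges H) + card (edges B)" by (simp add: card_Un_le)
    also have "\<dots> \<le> 2 ^ (2 * r + 2) * n + 2 ^ (2 * r + 2) * 1"
      using H card_edges_block_le[OF r B(1)] by simp
    also have "\<dots> \<le> 2 ^ (2 * r + 2) * n + 2 ^ (2 * r + 2) * k"
      using B(3) by (intro add_left_mono mult_left_mono) auto
    finally show ?thesis by (simp add: distrib_left)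
  qed
  ultimately show ?thesis unfolding tileable_def by blast
qed

lemma tileable_0: "tileable r 0"
  unfolding tileable_def
  by (intro exI[of _ "({}, {})"]) (auto simp: tiled_def r_graph_def)

lemma tileable_add_complete:
  assumes r: "r \<ge> 2" and n: "tileable r n" shows "tileable r (n + 2 * r)"
proof (rule tileable_add_block[OF r n])
  let ?B = "({n..<n + 2 * r}, {e. e \<subseteq> {n..<n + 2 * r} \<and> card e = r})"
  show "block r ?B" unfolding block_def complete_block_def by simp
qed (use r in auto)

lemma tileable_add_crossing:
  assumes r: "r \<ge> 2" and n: "tileable r n" shows "tileable r (n + (2 * r + 2))"
proof (rule tileable_add_block[OF r n])
  let ?P = "{n..<n + (r + 1)}" and ?Q = "{n + (r + 1)..<n + (2 * r + 2)}"
  let ?B = "({n..<n + (2 * r + 2)}, crossing_sets r ?P ?Q)"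
  have "crossing_block r ?B"
    unfolding crossing_block_def by (intro exI[of _ ?P] exI[of _ ?Q]) auto
  then show "block r ?B" unfolding block_def by simp
qed auto

lemma tileable_combination:
  assumes r: "r \<ge> 2" shows "tileable r (x * (2 * r) + y * (2 * r + 2))"
proof (induction y)
  case 0
  show ?case
  proof (induction x)
    case 0 show ?case using tileable_0 by simp
  next
    case (Suc x)
    then show ?case using tileable_add_complete[OF r Suc] by (simp add: algebra_simps)
  qed
next
  case (Suc y)
  then show ?case using tileable_add_crossing[OF r Suc] by (simp add: algebra_simps)
qed

lemma tileable_even:
  assumes r: "r \<ge> 2" and n: "even n" "n \<ge> 2 * (r * r)"
  shows "tileable r n"
proof -
  obtain m where m: "n = 2 * m" using n by auto
  \<comment> \<open>Solve \<open>m = x * r + y * (r + 1)\<close>; the solution with \<open>y < r\<close> has \<open>x \<ge> 0\<close> as \<open>m \<ge> r * r\<close>.\<close>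
  define y where "y = m mod r"
  define x where "x = m div r - y"
  have "y < r" using r unfolding y_def by simp
  moreover have "r \<le> m div r" using n m r by (simp add: less_eq_div_iff_mult_less_eq)
  ultimately have "m div r = x + y" unfolding x_def by simp
  then have "m = (x + y) * r + y" unfolding y_def by (metis div_mult_mod_eq)
  then have "n = x * (2 * r) + y * (2 * r + 2)" unfolding m by (simp add: algebra_simps)
  then show ?thesis using tileable_combination[OF r] by metis
qed

lemma sat_even_le:
  assumes r: "r \<ge> 2" and n: "even n" "n \<ge> 2 * (r * r)"
  shows "sat r (obstructions r) n \<le> 2 ^ (2 * r + 2) * n"
proof -
  obtain H :: "nat hypergraph" where H: "verts H = {..<n}" "tiled r H" 
      "card (edges H) \<le> 2 ^ (2 * r + 2) * n"
    using tileable_even[OF assms] unfolding tileable_def by auto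
  have "card (edges H) \<in> {card (edges H) | H :: nat hypergraph.
      card (verts H) = n \<and> saturated r (obstructions r) H}"
    using H(1) tiled_saturated[OF r H(2)] by (intro CollectI exI[of _ H]) simp
  then have "sat r (obstructions r) n \<le> card (edges H)"
    unfolding sat_def by (intro cInf_lower) auto
  then show ?thesis using H by simp
qed

section \<open>The lower bound for odd orders\<close>

text \<open>The infimum in \<open>sat\<close> ranges over a nonempty set: the empty graph avoids a family without
  edgeless members, and a maximal graph avoiding the family is saturated.\<close>

lemma saturated_exists:
  assumes ne: "\<And>F. F \<in> \<F> \<Longrightarrow> edges F \<noteq> {}" and V: "finite V"
  obtains E where "saturated r \<F> (V, E)"
proof -
  define \<A> where "\<A> = {E. E \<subseteq> {e. e \<subseteq> V \<and> card e = r} \<and> (\<forall>F\<in>\<F>. \<not> contains_copy (V, E) F)}"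
  have "finite \<A>"
    by (rule finite_subset[of _ "Pow (Pow V)"]) (use V in \<open>auto simp: \<A>_def\<close>)
  moreover have "{} \<in> \<A>" using ne unfolding \<A>_def contains_copy_def by fastforce
  ultimately obtain E where E: "E \<in> \<A>" and max: "\<And>E'. E' \<in> \<A> \<Longrightarrow> E \<subseteq> E' \<Longrightarrow> E' = E"
    using finite_has_maximal[of \<A>] by (metis empty_iff)
  have "saturated r \<F> (V, E)"
    unfolding saturated_def
  proof (intro conjI allI impI)
    show "r_graph r (V, E)" using E V unfolding \<A>_def r_graph_def by auto
    show "\<forall>F\<in>\<F>. \<not> contains_copy (V, E) F" using E unfolding \<A>_def by simp
    fix e assume e: "e \<subseteq> verts (V, E) \<and> card e = r \<and> e \<notin> edges (V, E)"
    then have "insert e E \<notin> \<A>" using max[of "insert e E"] by auto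
    then show "\<exists>F\<in>\<F>. contains_copy (verts (V, E), insert e (edges (V, E))) F"
      using E e unfolding \<A>_def by auto
  qed
  then show ?thesis using that by blast
qed

lemma blocks_disjoint:
  assumes r: "r \<ge> 2" and H: "saturated r (obstructions r) H"
    and B: "block r B" "subgraph B H" and C: "block r C" "subgraph C H"
    and meet: "verts B \<inter> verts C \<noteq> {}"
  shows "B = C"
proof (rule ccontr)
  assume ne: "B \<noteq> C"
  define G where "G = (verts B \<union> verts C, edges B \<union> edges C)"
  have sub: "subgraph B G" "subgraph C G" "subgraph G H"
    using B C unfolding G_def subgraph_def by auto
  have rG: "r_graph r G"
    using r_graph_block[OF r B(1)] r_graph_block[OF r C(1)] unfolding G_def r_graph_def by auto
  \<comment> \<open>If both were isolated in their union, each would absorb the other.\<close>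
  have "\<not> isolated B G \<or> \<not> isolated C G"
  proof (rule ccontr)
    assume "\<not> ?thesis"
    then have "subgraph C B" "subgraph B C"
      using isolated_block_absorbs[OF r B(1) _ C(1) sub(2)] isolated_block_absorbs[OF r C(1) _ B(1) sub(1)]
        meet by (simp_all add: Int_commute)
    then show False using ne unfolding subgraph_def by (auto intro: prod_eqI)
  qed
  then have "\<exists>B. block r B \<and> subgraph B G \<and> \<not> isolated B G" using B C sub by blast
  moreover have "\<forall>v\<in>verts G. \<exists>B. block r B \<and> subgraph B G \<and> v \<in> verts B"
    
  proof
    fix v assume "v \<in> verts G"
    then consider "v \<in> verts B" | "v \<in> verts C" unfolding G_def by auto
    then show "\<exists>B. block r B \<and> subgraph B G \<and> v \<in> verts B" using B C sub by cases blast+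
  qed
  ultimately have "obstruction r G" using rG unfolding obstruction_def by blast
  moreover have "card (verts G) \<le> r * (2 * r + 2)"
  proof -
    have "card (verts G) \<le> card (verts B) + card (verts C)" unfolding G_def by (simp add: card_Un_le)
    also have "\<dots> \<le> 2 * (2 * r + 2)"
      using card_verts_block_le[OF B(1)] card_verts_block_le[OF C(1)] by simp
    also have "\<dots> \<le> r * (2 * r + 2)" using r by (intro mult_right_mono) auto
    finally show ?thesis .
  qed
  ultimately obtain F where "F \<in> obstructions r" "contains_copy H F"
    using contains_obstruction sub(3) by metis
  then show False using H unfolding saturated_def by auto
qed

lemma odd_uncovered_vertex:
  assumes r: "r \<ge> 2" and H: "saturated r (obstructions r) H" and odd: "odd (card (verts H))"
  obtains v where "v \<in> verts H" "\<And>B. block r B \<Longrightarrow> subgraph B H \<Longrightarrow> v \<notin> verts B"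
proof (rule ccontr)
  assume none: "\<not> thesis"
  have cov: "\<forall>v\<in>verts H. \<exists>B. block r B \<and> subgraph B H \<and> v \<in> verts B"
    using that none by blast
  define \<C> where "\<C> = verts ` {B. block r B \<and> subgraph B H}"
  have un: "\<Union>\<C> = verts H"
    using cov unfolding \<C>_def subgraph_def by blast
  have "finite (verts H)" using H unfolding saturated_def r_graph_def by auto
  moreover have "2 dvd card c" if "c \<in> \<C>" for c
    using that even_card_verts_block unfolding \<C>_def by auto
  moreover have "c \<inter> d = {}" if "c \<in> \<C>" "d \<in> \<C>" "c \<noteq> d" for c d
    using that blocks_disjoint[OF r H] unfolding \<C>_def by blast
  ultimately have "2 dvd card (\<Union>\<C>)"
    using un by (intro dvd_partition) auto
  then show False using odd un by simp
qed

text \<open>If \<open>v\<close> lies in no block of \<open>H\<close>, then every \<open>(r-1)\<close>-set avoiding \<open>v\<close> is contained in an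
  edge of \<open>H\<close>.\<close>

lemma shadow_covered:
  assumes r: "r \<ge> 2" and H: "saturated r (obstructions r) H"
    and v: "v \<in> verts H" "\<And>B. block r B \<Longrightarrow> subgraph B H \<Longrightarrow> v \<notin> verts B"
    and T: "T \<subseteq> verts H - {v}" "card T = r - 1"
  obtains g where "g \<in> edges H" "T \<subseteq> g"
proof (cases "insert v T \<in> edges H")
  case True
  then show ?thesis using that by blast
next
  case False
  define e where "e = insert v T"
  have "finite T" using T r by (intro card_ge_0_finite) simp
  moreover have "v \<notin> T" using T by auto
  ultimately have "card e = r" using T r unfolding e_def by (simp add: card_insert_if)
  moreover have "e \<subseteq> verts H" using v T unfolding e_def by auto
  ultimately obtain F where F: "F \<in> obstructions r" "contains_copy (verts H, insert e (edges H)) F"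
    using H False unfolding saturated_def e_def by blast
  then obtain \<phi> where \<phi>: "inj_on \<phi> (verts F)"
      "subgraph (image_graph \<phi> F) (verts H, insert e (edges H))"
    unfolding contains_copy_iff_image by auto
  define G where "G = image_graph \<phi> F"
  have G: "obstruction r G"
    using obstruction_image[OF \<phi>(1)] F unfolding G_def obstructions_def by simp
  have "e \<in> edges G"
  proof (rule ccontr)
    assume "e \<notin> edges G"
    then have "subgraph G H" using \<phi>(2) unfolding G_def subgraph_def by auto
    then show False using H F(1) \<phi>(1) 
      unfolding saturated_def contains_copy_iff_image G_def by auto
  qed
  then have "v \<in> verts G" using G unfolding obstruction_def r_graph_def e_def by auto
  then obtain B where B: "block r B" "subgraph B G" "v \<in> verts B"
    using G unfolding obstruction_def by auto
  have BH: "subgraph B (verts H, insert e (edges H))"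
    using B(2) \<phi>(2) subgraph_trans unfolding G_def by blast
  \<comment> \<open>The block of the copy through \<open>v\<close> is not a block of \<open>H\<close>, so it uses the new edge.\<close>
  have "e \<in> edges B"
  proof (rule ccontr)
    assume "e \<notin> edges B"
    then have "subgraph B H" using BH unfolding subgraph_def by auto
    then show False using v B by blast
  qed
  then obtain g where "g \<in> edges B" "g \<noteq> e" "e - {v} \<subseteq> g"
    using block_cover[OF r B(1), of e v] unfolding e_def by blast
  moreover have "e - {v} = T" using \<open>v \<notin> T\<close> unfolding e_def by auto
  ultimately show ?thesis using that[of g] BH unfolding subgraph_def by auto
qed

lemma saturated_odd_card_edges_ge:
  assumes r: "r \<ge> 2" and H: "saturated r (obstructions r) H" and odd: "odd (card (verts H))"
  shows "(card (verts H) - 1) choose (r - 1) \<le> 2 ^ r * card (edges H)"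
proof -
  have rH: "r_graph r H" using H unfolding saturated_def by simp
  then have fin: "finite (verts H)" and finE: "finite (edges H)"
    unfolding r_graph_def by (auto intro: finite_subset[of _ "Pow (verts H)"])
  have fe: "finite e" "card e = r" if "e \<in> edges H" for e
    using that rH fin unfolding r_graph_def by (auto intro: finite_subset)
  obtain v where v: "v \<in> verts H" "\<And>B. block r B \<Longrightarrow> subgraph B H \<Longrightarrow> v \<notin> verts B"
    using odd_uncovered_vertex[OF assms] by blast
  let ?S = "{T. T \<subseteq> verts H - {v} \<and> card T = r - 1}"
  have "?S \<subseteq> (\<Union>e\<in>edges H. Pow e)"
  proof
    fix T assume "T \<in> ?S"
    then obtain g where "g \<in> edges H" "T \<subseteq> g" using shadow_covered[OF r H v, of T] by blast
    then show "T \<in> (\<Union>e\<in>edges H. Pow e)" by blast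
  qed
  then have "card ?S \<le> card (\<Union>e\<in>edges H. Pow e)"
    using finE fe by (intro card_mono) auto
  also have "\<dots> \<le> (\<Sum>e\<in>edges H. card (Pow e))" using card_UN_le[OF finE] .
  also have "\<dots> = 2 ^ r * card (edges H)" using fe by (simp add: card_Pow)
  finally show ?thesis using n_subsets[of "verts H - {v}" "r - 1"] fin v by simp
qed

lemma sat_odd_ge:
  assumes r: "r \<ge> 2" and n: "odd n"
  shows "(n - 1) choose (r - 1) \<le> 2 ^ r * sat r (obstructions r) n"
proof -
  let ?K = "{card (edges H) | H :: nat hypergraph.
      card (verts H) = n \<and> saturated r (obstructions r) H}"
  have "edges F \<noteq> {}" if "F \<in> obstructions r" for F
    using that unfolding obstructions_def obstruction_def isolated_def by auto
  then obtain E where "saturated r (obstructions r) ({..<n}, E)"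
    using saturated_exists[of "obstructions r" "{..<n}" r] by blast
  then have "?K \<noteq> {}" by force
  then have "sat r (obstructions r) n \<in> ?K" unfolding sat_def by (rule Inf_nat_def1)
  then show ?thesis using saturated_odd_card_edges_ge[OF r] n by auto
qed

section \<open>Saturation numbers depending on the parity\<close>

theorem theorem5:
  fixes r :: nat
  assumes "r \<ge> 2"
  shows "\<exists>\<F> :: nat hypergraph set.
           finite \<F> \<and> (\<forall>F\<in>\<F>. r_graph r F) \<and>
           (\<lambda>n. real (sat r \<F> n)) \<in> O[inf sequentially (principal {n. even n})](\<lambda>n. real n) \<and>
           (\<lambda>n. real (sat r \<F> n)) \<in> \<Omega>[inf sequentially (principal {n. odd n})](\<lambda>n. real n ^ (r - 1))"
proof (intro exI[of _ "obstructions r"] conjI)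
  show "finite (obstructions r)" by (rule finite_obstructions)
  show "\<forall>F\<in>obstructions r. r_graph r F" unfolding obstructions_def obstruction_def by auto
  have "\<forall>\<^sub>F n in sequentially. even n \<longrightarrow>
      norm (real (sat r (obstructions r) n)) \<le> 2 ^ (2 * r + 2) * norm (real n)"
    using eventually_ge_at_top[of "2 * (r * r)"]
  proof eventually_elim
    case (elim n)
    show ?case
    proof
      assume "even n"
      then have "real (sat r (obstructions r) n) \<le> real (2 ^ (2 * r + 2) * n)"
        using sat_even_le[OF assms _ elim] by (simp only: of_nat_le_iff)
      then show "norm (real (sat r (obstructions r) n)) \<le> 2 ^ (2 * r + 2) * norm (real n)" by simp
    qed
  qed
  then show "(\<lambda>n. real (sat r (obstructions r) n))
      \<in> O[inf sequentially (principal {n. even n})](\<lambda>n. real n)"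
    by (intro bigoI[of _ "2 ^ (2 * r + 2)"]) (simp add: eventually_inf_principal)
  define k where "k = r - 1"
  have k: "k \<ge> 1" using assms unfolding k_def by simp
  \<comment> \<open>From \<open>(n-1 choose k) \<ge> ((n-1)/k)^k \<ge> (n/(2k))^k\<close> and the factor \<open>2^r\<close> in the lower bound.\<close>
  define c where "c = 1 / (2 ^ r * (2 * real k) ^ k)"
  have c: "c > 0" using k unfolding c_def by simp
  have "\<forall>\<^sub>F n in sequentially. odd n \<longrightarrow>
      norm (real (sat r (obstructions r) n)) \<ge> c * norm (real n ^ k)"
    using eventually_ge_at_top[of "r + 2"]
  proof eventually_elim
    case (elim n)
    show ?case
    proof
      assume odd: "odd n"
      have "real n / (2 * real k) \<le> real (n - 1) / real k"
        using elim k by (simp add: field_simps of_nat_diff)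
      then have "(real n / (2 * real k)) ^ k \<le> (real (n - 1) / real k) ^ k"
        using k by (intro power_mono) auto
      also have "\<dots> \<le> real ((n - 1) choose k)"
        using binomial_ge_n_over_k_pow_k[of k "n - 1", where ?'a = real] elim unfolding k_def by simp
      also have "\<dots> \<le> real (2 ^ r * sat r (obstructions r) n)"
        using sat_odd_ge[OF assms odd] unfolding k_def by (simp only: of_nat_le_iff)
      finally show "norm (real (sat r (obstructions r) n)) \<ge> c * norm (real n ^ k)"
        using k unfolding c_def by (simp add: field_simps)
    qed
  qed
  then show "(\<lambda>n. real (sat r (obstructions r) n))
      \<in> \<Omega>[inf sequentially (principal {n. odd n})](\<lambda>n. real n ^ (r - 1))"
    using c by (intro landau_omega.bigI[of c]) (simp_all add: eventually_inf_principal k_def)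
qed

end
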